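(* Let $G$ be a simple graph with $n$ vertices, let $C_{n-1}=\{ i\cdot j \mid 0\le i,j\le n-1\}$ (a set of integers), and let $\mathcal{G}(M_2,t)=\sum_{p=0}^\infty M_2^{(p)}(G)\, t^p$ be the ordinary generating function of the general second Zagreb indices. Then (i) $$\mathcal{G}(M_2,t)=\frac{\displaystyle \sum_{k=0}^{|C_{n-1}|-1} \left( \sum_{i=\max(0, k-|C_{n-1}|)}^{\min(k,|C_{n-1}|)} \left [ {C_{n-1}} \atop {|C_{n-1}|-i}\right ] M_2^{(k-i)}(G) \right) t^k }{\prod\limits_{c \in C_{n-1}}(1- c\, t)};$$ (ii) $$M_2^{(|C_{n-1}|)}(G)=-\sum_{i=1}^{|C_{n-1}|-1} \left [ {C_{n-1}} \atop {i}\right ] M_2^{(i)}(G).$$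
   Context: $G$ is a finite simple graph with $n$ vertices and edge set $E(G)$; $d_v$ denotes the degree of vertex $v$. For an integer $p\ge 0$, the general second Zagreb index is $M_2^{(p)}(G)=\sum_{\{u,v\}\in E(G)} (d_u d_v)^p$. For a finite set $S$ of nonnegative integers, the Comtet numbers of the first kind $\left[ {S \atop i}\right]$, $0\le i\le |S|$, are defined by $\prod_{s\in S}(z-s)=\sum_{i=0}^{|S|}\left[ {S \atop i}\right] z^i$. The generating function identity in (i) is an identity of formal power series in $t$. *)

theory Defs
  imports
    "HOL-Computational_Algebra.Polynomial"
    "HOL-Computational_Algebra.Formal_Power_Series"
begin

definition simple_graph :: "'a set \<Rightarrow> 'a set set \<Rightarrow> bool" where
  "simple_graph V E \<longleftrightarrow> finite V \<and> E \<subseteq> {{u, v} | u v. u \<in> V \<and> v \<in> V \<and> u \<noteq> v}"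

definition vdegree :: "'a set set \<Rightarrow> 'a \<Rightarrow> nat" where
  "vdegree E v = card {e \<in> E. v \<in> e}"

text \<open>For an edge \<open>e = {u, v}\<close> with \<open>u \<noteq> v\<close>, the product over the elements of \<open>e\<close> is
  \<open>d\<^sub>u d\<^sub>v\<close>.\<close>

definition zagreb2 :: "'a set set \<Rightarrow> nat \<Rightarrow> nat" where
  "zagreb2 E p = (\<Sum>e\<in>E. (\<Prod>v\<in>e. vdegree E v) ^ p)"

definition zagreb2_gf :: "'a set set \<Rightarrow> rat fps" where
  "zagreb2_gf E = Abs_fps (\<lambda>p. of_nat (zagreb2 E p))"

definition comtet1 :: "nat set \<Rightarrow> nat \<Rightarrow> int" where
  "comtet1 S i = coeff (\<Prod>s\<in>S. [:- int s, 1:]) i"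

text \<open>The set \<open>C\<^bsub>n-1\<^esub>\<close>, indexed by \<open>n\<close> so that no subtraction on \<open>nat\<close> occurs.\<close>

definition degree_products :: "nat \<Rightarrow> nat set" where
  "degree_products n = {i * j | i j. i < n \<and> j < n}"

end

theory Submission
  imports Defs
begin

text \<open>
  Every edge \<open>e = {u, v}\<close> contributes \<open>x\<^sup>p\<close> to the \<open>p\<close>-th index, where \<open>x = d\<^sub>u d\<^sub>v\<close> lies in \<open>C\<close>
  because all degrees are below \<open>n\<close>. So \<open>x\<close> is a root of the product of the \<open>z - c\<close>, and summing
  over the edges shows that the indices satisfy the linear recurrence whose coefficients are
  the Comtet numbers. The denominator in (i) is the reversed characteristic polynomial of this
  recurrence, hence its product with the generating function has no coefficients beyond
  \<open>|C| - 1\<close>. Part (ii) is the first instance of the recurrence; its constant term vanishes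
  because \<open>0 \<in> C\<close>.
\<close>

text \<open>Multiplication by \<open>z - c\<close> shifts the coefficients up by one and subtracts
  \<open>c\<close> times the old ones. This drives the inductions on \<open>S\<close> below.\<close>

lemma comtet1_insert:
  assumes "finite S" "c \<notin> S"
  shows "comtet1 (insert c S) i = (case i of 0 \<Rightarrow> 0 | Suc j \<Rightarrow> comtet1 S j) - int c * comtet1 S i"
  using assms by (simp add: comtet1_def coeff_pCons split: nat.split)

lemma comtet1_eq_0:
  assumes "finite S" "card S < i"
  shows "comtet1 S i = 0"
  using assms
proof (induction S arbitrary: i rule: finite_induct)
  case empty
  then show ?case by (simp add: comtet1_def)
next
  case (insert c S)
  then show ?case by (simp add: comtet1_insert split: nat.split)
qed

lemma comtet1_card:
  assumes "finite S"
  shows "comtet1 S (card S) = 1"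
  using assms
proof (induction S rule: finite_induct)
  case empty
  then show ?case by (simp add: comtet1_def)
next
  case (insert c S)
  then show ?case by (simp add: comtet1_insert comtet1_eq_0)
qed

lemma comtet1_0:
  assumes "finite S" "0 \<in> S"
  shows "comtet1 S 0 = 0"
proof -
  have "comtet1 S 0 = (\<Prod>s\<in>S. - int s)"
    by (simp add: comtet1_def flip: poly_0_coeff_0) (simp add: poly_prod)
  also have "\<dots> = 0"
    using assms by (auto intro!: prod_zero)
  finally show ?thesis .
qed

lemma comtet1_root:
  assumes "finite S" "x \<in> S"
  shows "(\<Sum>i\<le>card S. comtet1 S i * int x ^ i) = 0"
proof -
  let ?p = "\<Prod>s\<in>S. [:- int s, 1:]"
  have "degree ?p \<le> card S"
    using comtet1_eq_0[OF assms(1)] unfolding comtet1_def by (intro degree_le) auto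
  \<comment> \<open>\<open>poly_altdef\<close> sums only up to the degree; the other indices up to
    \<open>card S\<close> have coefficient zero.\<close>
  then have "(\<Sum>i\<le>card S. comtet1 S i * int x ^ i) = poly ?p (int x)"
    unfolding poly_altdef comtet1_def
    by (intro sum.mono_neutral_right) (auto simp: coeff_eq_0)
  also have "\<dots> = 0"
    using assms by (auto simp: poly_prod intro!: prod_zero)
  finally show ?thesis .
qed

text \<open>Reversal of coefficients: \<open>1 - c t\<close> is \<open>t\<close> times
  \<open>z - c\<close> at \<open>z = 1/t\<close>, so the index \<open>i\<close> becomes
  \<open>card S - i\<close>.\<close>

lemma fps_nth_prod_one_minus:
  assumes "finite S"
  shows "fps_nth (\<Prod>c\<in>S. 1 - fps_const (of_nat c :: 'b::comm_ring_1) * fps_X) i =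
    (if i \<le> card S then of_int (comtet1 S (card S - i)) else 0)"
  using assms
proof (induction S arbitrary: i rule: finite_induct)
  case empty
  then show ?case by (simp add: comtet1_def)
next
  case (insert c S)
  have "fps_nth ((1 - fps_const (of_nat c :: 'b) * fps_X) * F) i =
      fps_nth F i - of_nat c * (case i of 0 \<Rightarrow> 0 | Suc j \<Rightarrow> fps_nth F j)" for F
    by (simp add: left_diff_distrib mult.assoc split: nat.split)
  then show ?case
    using insert
    by (auto simp: comtet1_insert comtet1_eq_0 Suc_diff_le le_Suc_eq Suc_diff_Suc split: nat.split)
qed

text \<open>An edge at \<open>v\<close> is determined by its other endpoint, which lies in
  \<open>V - {v}\<close>.\<close>

lemma vdegree_less:
  assumes "simple_graph V E" "v \<in> V"
  shows "vdegree E v < card V"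
proof -
  have fin: "finite V" and E: "E \<subseteq> {{u, v} | u v. u \<in> V \<and> v \<in> V \<and> u \<noteq> v}"
    using assms by (auto simp: simple_graph_def)
  have "{e \<in> E. v \<in> e} \<subseteq> (\<lambda>u. {v, u}) ` (V - {v})"
    using E by fastforce
  then have "vdegree E v \<le> card (V - {v})"
    unfolding vdegree_def using fin by (intro surj_card_le) auto
  also have "\<dots> < card V"
    using fin assms(2) by (rule card_Diff1_less)
  finally show ?thesis .
qed

lemma prod_vdegree_mem:
  assumes "simple_graph V E" "e \<in> E"
  shows "(\<Prod>v\<in>e. vdegree E v) \<in> degree_products (card V)"
proof -
  obtain u v where "e = {u, v}" "u \<in> V" "v \<in> V" "u \<noteq> v"
    using assms by (auto simp: simple_graph_def)
  then show ?thesis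
    using vdegree_less[OF assms(1)] by (auto simp: degree_products_def)
qed

lemma finite_degree_products: "finite (degree_products n)"
proof -
  have "degree_products n = (\<lambda>(i, j). i * j) ` ({..<n} \<times> {..<n})"
    by (auto simp: degree_products_def)
  then show ?thesis by simp
qed

text \<open>The offset \<open>m\<close> only multiplies the contribution of each edge by
  \<open>x e ^ m\<close>, so the relation holds from any starting index.\<close>

lemma zagreb2_recurrence:
  assumes "finite S" "\<And>e. e \<in> E \<Longrightarrow> (\<Prod>v\<in>e. vdegree E v) \<in> S"
  shows "(\<Sum>i\<le>card S. comtet1 S i * int (zagreb2 E (m + i))) = 0"
proof -
  define x where "x e = (\<Prod>v\<in>e. vdegree E v)" for e
  have "(\<Sum>i\<le>card S. comtet1 S i * int (zagreb2 E (m + i))) =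
      (\<Sum>i\<le>card S. \<Sum>e\<in>E. comtet1 S i * int (x e) ^ (m + i))"
    by (simp add: zagreb2_def x_def sum_distrib_left)
  also have "\<dots> = (\<Sum>e\<in>E. \<Sum>i\<le>card S. comtet1 S i * int (x e) ^ (m + i))"
    by (rule sum.swap)
  also have "\<dots> = (\<Sum>e\<in>E. int (x e) ^ m * (\<Sum>i\<le>card S. comtet1 S i * int (x e) ^ i))"
    by (simp add: sum_distrib_left power_add mult_ac)
  also have "\<dots> = 0"
    using comtet1_root[OF assms(1) assms(2)[folded x_def]] by simp
  finally show ?thesis .
qed

lemma zagreb2_gf_times_prod:
  assumes "finite S" "\<And>e. e \<in> E \<Longrightarrow> (\<Prod>v\<in>e. vdegree E v) \<in> S"
  shows "zagreb2_gf E * (\<Prod>c\<in>S. 1 - fps_const (of_nat c) * fps_X) =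
    (\<Sum>k<card S. fps_const (\<Sum>i\<le>k. of_int (comtet1 S (card S - i)) * of_nat (zagreb2 E (k - i)))
      * fps_X ^ k)" (is "_ * ?D = (\<Sum>k<_. fps_const (?a k) * _)")
proof (rule fps_ext)
  fix k
  have rhs: "fps_nth (\<Sum>k<card S. fps_const (?a k) * fps_X ^ k) k = (if k < card S then ?a k else 0)"
    by (simp add: fps_sum_nth fps_X_power_nth if_distrib[of "(*) _"] cong: if_cong)
  have lhs: "fps_nth (zagreb2_gf E * ?D) k =
      (\<Sum>i\<le>k. if i \<le> card S then of_int (comtet1 S (card S - i)) * of_nat (zagreb2 E (k - i)) else 0)"
    by (subst mult.commute, simp add: fps_mult_nth fps_nth_prod_one_minus[OF assms(1)]
        zagreb2_gf_def atLeast0AtMost, intro sum.cong) auto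
  show "fps_nth (zagreb2_gf E * ?D) k = fps_nth (\<Sum>k<card S. fps_const (?a k) * fps_X ^ k) k"
  proof (cases "k < card S")
    case True
    then show ?thesis unfolding lhs rhs by (auto intro!: sum.cong)
  next
    case False
    \<comment> \<open>From \<open>card S\<close> on, the convolution contains all coefficients of
      the denominator. Reversing the index turns it into the recurrence with offset
      \<open>k - card S\<close>.\<close>
    have "(\<Sum>i\<le>k. if i \<le> card S then of_int (comtet1 S (card S - i)) * of_nat (zagreb2 E (k - i)) else 0)
        = (\<Sum>i\<le>card S. of_int (comtet1 S (card S - i)) * (of_nat (zagreb2 E (k - i)) :: rat))"
      using False by (intro sum.mono_neutral_cong_right) auto
    also have "\<dots> = (\<Sum>i\<le>card S. of_int (comtet1 S i) * of_nat (zagreb2 E (k - card S + i)))"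
      using False by (intro sum.reindex_bij_witness[of _ "\<lambda>i. card S - i" "\<lambda>i. card S - i"]) auto
    also have "\<dots> = of_int (\<Sum>i\<le>card S. comtet1 S i * int (zagreb2 E (k - card S + i)))"
      by simp
    also have "\<dots> = 0"
      by (subst zagreb2_recurrence[OF assms]) auto
    finally show ?thesis
      unfolding lhs rhs using False by simp
  qed
qed

theorem theorem3:
  fixes V :: "'a set" and E :: "'a set set" and n :: nat and C :: "nat set"
  assumes "simple_graph V E" and "card V = n" and "C = degree_products n"
  shows "(zagreb2_gf E =
      (\<Sum>k<card C.
          fps_const (\<Sum>i = max 0 (k - card C)..min k (card C).
            of_int (comtet1 C (card C - i)) * of_nat (zagreb2 E (k - i))) * fps_X ^ k)
      / (\<Prod>c\<in>C. 1 - fps_const (of_nat c) * fps_X))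
    \<and> int (zagreb2 E (card C)) =
      - (\<Sum>i = 1..<card C. comtet1 C i * int (zagreb2 E i))"
proof
  have fin: "finite C"
    using assms(3) finite_degree_products by simp
  have mem: "(\<Prod>v\<in>e. vdegree E v) \<in> C" if "e \<in> E" for e
    using prod_vdegree_mem[OF assms(1) that] assms by simp
  let ?D = "\<Prod>c\<in>C. 1 - fps_const (of_nat c :: rat) * fps_X"
  \<comment> \<open>The constant term is the leading Comtet number, so the denominator is nonzero
    and can be cancelled.\<close>
  have "fps_nth ?D 0 = 1"
    by (simp add: fps_nth_prod_one_minus fin comtet1_card)
  then have "?D \<noteq> 0" by auto
  then have "zagreb2_gf E = zagreb2_gf E * ?D / ?D"
    by (rule nonzero_mult_div_cancel_right[symmetric])
  also note zagreb2_gf_times_prod[OF fin mem]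
  finally show "zagreb2_gf E =
      (\<Sum>k<card C.
          fps_const (\<Sum>i = max 0 (k - card C)..min k (card C).
            of_int (comtet1 C (card C - i)) * of_nat (zagreb2 E (k - i))) * fps_X ^ k) / ?D"
    \<comment> \<open>For \<open>k < card C\<close>, truncated subtraction gives
      \<open>k - card C = 0\<close>, and \<open>min k (card C) = k\<close>.\<close>
    by (simp add: atLeast0AtMost)
  show "int (zagreb2 E (card C)) = - (\<Sum>i = 1..<card C. comtet1 C i * int (zagreb2 E i))"
  \<comment> \<open>For \<open>n = 0\<close> the set \<open>C\<close> is empty and lacks
    \<open>0\<close>; an edge rules this out, and without edges all indices vanish.\<close>
  proof (cases "E = {}")
    case True
    then show ?thesis by (simp add: zagreb2_def)
  next
    case False
    then have "C \<noteq> {}" using mem by auto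
    then have "0 \<in> C" using assms(3) by (force simp: degree_products_def)
    \<comment> \<open>The two end terms split off: the constant coefficient is zero and the leading
      one is \<open>1\<close>. They are distinct because \<open>card C \<noteq> 0\<close>.\<close>
    have "{..card C} = insert 0 (insert (card C) {1..<card C})" by auto
    moreover have "card C \<noteq> 0" using fin \<open>C \<noteq> {}\<close> by simp
    ultimately show ?thesis
      using zagreb2_recurrence[OF fin mem, where m = 0]
      by (simp add: comtet1_card comtet1_0 fin \<open>0 \<in> C\<close>)
  qed
qed

end
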